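(* Let $k=3$ and let either $m=1$, $r=0$ or $m=0$, $r=1$. Then for the HC-model, with $\lambda_{cr}=\frac{27}{4}$: (i) for $0<\lambda<\lambda_{cr}$ there is a unique AGM (with parameters $m,r$), and it coincides with the only TIGM $\mu_0$; (ii) for $\lambda=\lambda_{cr}$ there are exactly two AGMs $\mu_0$ and $\mu'$, where $\mu'$ is an AGM that is not TI; (iii) for $\lambda>\lambda_{cr}$ there are exactly three AGMs $\mu_0$, $\mu_1$ and $\mu_2$, where $\mu_1$ and $\mu_2$ are AGMs that are not TI.
   Context: Half-tree: let $V$ be the vertex set of the infinite rooted tree with root $x^0$ in which every vertex $x$ has exactly $k$ direct successors, forming the set $S(x)$ (so the root has $k$ nearest neighbours and every other vertex has $k+1$). $W_n$ is the set of vertices at distance $n$ from $x^0$, and $V_n=\bigcup_{j=0}^n W_j$. HC-model (hard-core model): a configuration $\sigma: V\to\{0,1\}$ is admissible if $\sigma(x)\sigma(y)=0$ for all nearest neighbours $x,y$; $\Omega$ (resp. $\Omega_{V_n}$) is the set of admissible configurations on $V$ (resp. $V_n$). For $\sigma_n\in\Omega_{V_n}$, $\#\sigma_n$ is the number of $x\in V_n$ with $\sigma_n(x)=1$. For $\lambda>0$ and a positive function $z: x\mapsto z_x$ on $V$, put $z_{0,x}=1$, $z_{1,x}=z_x$ and $\mu^{(n)}(\sigma_n)=\frac1{Z_n}\lambda^{\#\sigma_n}\prod_{x\in W_n}z_{\sigma_n(x),x}$ on $\Omega_{V_n}$, with $Z_n$ the normalizing constant. If $z_x=\prod_{y\in S(x)}(1+\lambda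 z_y)^{-1}$ for all $x\in V$, these measures are consistent and define a unique probability measure on $\Omega$ with marginals $\mu^{(n)}$, the (splitting) Gibbs measure corresponding to $z$. It is translation-invariant (a TIGM) if $z_x$ is constant; for each $\lambda>0$ the TIGM exists and is unique. Alternative Gibbs measures (AGM) with parameters $m,r$ ($0\le m,r\le k$ integers): consider functions $z$ taking values in $\{h,l\}$ such that if $z_x=h$ then $z_y=h$ on $m$ vertices $y$ of $S(x)$ and $z_y=l$ on the remaining $k-m$; and if $z_x=l$ then $z_y=l$ on $r$ vertices $y$ of $S(x)$ and $z_y=h$ on the remaining $k-r$. The arrangement (which vertices get the symbol $h$ and which $l$) is fixed. Such $z$ satisfies the equation above when $h>0$, $l>0$ solve $$h=\frac{1}{(1+\lambda h)^m(1+\lambda l)^{k-m}},\qquad l=\frac{1}{(1+\lambda l)^r(1+\lambda h)^{k-r}}.$$ The AGMs are the Gibbs measures corresponding to the solutions $(h,l)$ of this system, one for each solution; solutions with $h=l$ give the TIGM, and solutions with $h\ne l$ give AGMs which are "not TI".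
   Formalization: Part (iii) is proved for λ > 27/4 with λ ≠ 8; at λ = 8 it fails, because one of the two further solutions is h = l = 1/8, the TIGM, so there are exactly two AGMs (μ_0 and one that is not TI), which is what is proved there. *)

theory Defs
  imports "HOL-Probability.Probability"
begin

text \<open>
  The rooted tree is modelled by words over \<open>{..<k}\<close>: the root is the empty word and the direct
  successors of \<open>x\<close> are the words \<open>i # x\<close>. Hence the length of a word is its distance from the root.
\<close>

definition tree_vertices :: "nat \<Rightarrow> nat list set" where
  "tree_vertices k = lists {..<k}"

definition succs :: "nat \<Rightarrow> nat list \<Rightarrow> nat list set" where
  "succs k x = (\<lambda>i. i # x) ` {..<k}"

definition neighbours :: "nat \<Rightarrow> nat list \<Rightarrow> nat list \<Rightarrow> bool" where
  "neighbours k x y \<longleftrightarrow> y \<in> succs k x \<or> x \<in> succs k y"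

definition level :: "nat \<Rightarrow> nat \<Rightarrow> nat list set" where
  "level k n = {x \<in> tree_vertices k. length x = n}"

definition tree_ball :: "nat \<Rightarrow> nat \<Rightarrow> nat list set" where
  "tree_ball k n = (\<Union>j\<in>{0..n}. level k j)"

definition admissible :: "nat \<Rightarrow> nat list set \<Rightarrow> (nat list \<Rightarrow> nat) set" where
  "admissible k A =
     {\<sigma> \<in> A \<rightarrow>\<^sub>E {0, 1}. \<forall>x\<in>A. \<forall>y\<in>A. neighbours k x y \<longrightarrow> \<sigma> x * \<sigma> y = 0}"

abbreviation configs :: "nat \<Rightarrow> (nat list \<Rightarrow> nat) set" where
  "configs k \<equiv> admissible k (tree_vertices k)"

abbreviation configs_upto :: "nat \<Rightarrow> nat \<Rightarrow> (nat list \<Rightarrow> nat) set" where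
  "configs_upto k n \<equiv> admissible k (tree_ball k n)"

text \<open>Only the \<open>\<sigma>\<close>-algebra of this space, generated by the cylinder sets, is used below.\<close>

definition config_space :: "nat \<Rightarrow> (nat list \<Rightarrow> nat) measure" where
  "config_space k =
     restrict_space (PiM (tree_vertices k) (\<lambda>_. count_space {0, 1})) (configs k)"

definition boundary_factor :: "(nat list \<Rightarrow> real) \<Rightarrow> nat \<Rightarrow> nat list \<Rightarrow> real" where
  "boundary_factor z s x = (if s = 0 then 1 else z x)"

definition hc_weight ::
  "nat \<Rightarrow> real \<Rightarrow> (nat list \<Rightarrow> real) \<Rightarrow> nat \<Rightarrow> (nat list \<Rightarrow> nat) \<Rightarrow> real" where
  "hc_weight k lam z n \<sigma> =
     lam ^ card {x \<in> tree_ball k n. \<sigma> x = 1} * (\<Prod>x\<in>level k n. boundary_factor z (\<sigma> x) x)"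

definition partition_function :: "nat \<Rightarrow> real \<Rightarrow> (nat list \<Rightarrow> real) \<Rightarrow> nat \<Rightarrow> real" where
  "partition_function k lam z n = (\<Sum>\<sigma>\<in>configs_upto k n. hc_weight k lam z n \<sigma>)"

definition finite_gibbs ::
  "nat \<Rightarrow> real \<Rightarrow> (nat list \<Rightarrow> real) \<Rightarrow> nat \<Rightarrow> (nat list \<Rightarrow> nat) \<Rightarrow> real" where
  "finite_gibbs k lam z n \<sigma> = hc_weight k lam z n \<sigma> / partition_function k lam z n"

definition hc_solution :: "nat \<Rightarrow> real \<Rightarrow> (nat list \<Rightarrow> real) \<Rightarrow> bool" where
  "hc_solution k lam z \<longleftrightarrow>
     (\<forall>x\<in>tree_vertices k. z x > 0 \<and> z x = (\<Prod>y\<in>succs k x. inverse (1 + lam * z y)))"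

text \<open>
  Since \<open>z\<close> solves the functional equation, the \<open>finite_gibbs k lam z n\<close> are consistent; the marginals
  on all balls determine the measure.
\<close>

definition gibbs_measure ::
  "nat \<Rightarrow> real \<Rightarrow> (nat list \<Rightarrow> real) \<Rightarrow> (nat list \<Rightarrow> nat) measure \<Rightarrow> bool" where
  "gibbs_measure k lam z \<mu> \<longleftrightarrow>
     hc_solution k lam z \<and>
     prob_space \<mu> \<and> sets \<mu> = sets (config_space k) \<and>
     (\<forall>n. \<forall>\<sigma>\<in>configs_upto k n.
        measure \<mu> {\<omega> \<in> configs k. restrict \<omega> (tree_ball k n) = \<sigma>} = finite_gibbs k lam z n \<sigma>)"

definition TIGMs :: "nat \<Rightarrow> real \<Rightarrow> (nat list \<Rightarrow> nat) measure set" where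
  "TIGMs k lam =
     {\<mu>. \<exists>z c. (\<forall>x\<in>tree_vertices k. z x = c) \<and> gibbs_measure k lam z \<mu>}"

datatype symbol = H | L

definition arrangement :: "nat \<Rightarrow> nat \<Rightarrow> nat \<Rightarrow> (nat list \<Rightarrow> symbol) \<Rightarrow> bool" where
  "arrangement k m r a \<longleftrightarrow>
     (\<forall>x\<in>tree_vertices k.
        (a x = H \<longrightarrow> card {y \<in> succs k x. a y = H} = m \<and> card {y \<in> succs k x. a y = L} = k - m) \<and>
        (a x = L \<longrightarrow> card {y \<in> succs k x. a y = L} = r \<and> card {y \<in> succs k x. a y = H} = k - r))"

definition agm_system :: "nat \<Rightarrow> nat \<Rightarrow> nat \<Rightarrow> real \<Rightarrow> real \<Rightarrow> real \<Rightarrow> bool" where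
  "agm_system k m r lam h l \<longleftrightarrow>
     h > 0 \<and> l > 0 \<and>
     h = 1 / ((1 + lam * h) ^ m * (1 + lam * l) ^ (k - m)) \<and>
     l = 1 / ((1 + lam * l) ^ r * (1 + lam * h) ^ (k - r))"

definition AGMs ::
  "nat \<Rightarrow> nat \<Rightarrow> nat \<Rightarrow> real \<Rightarrow> (nat list \<Rightarrow> symbol) \<Rightarrow> (nat list \<Rightarrow> nat) measure set" where
  "AGMs k m r lam a =
     {\<mu>. \<exists>h l. agm_system k m r lam h l \<and>
            gibbs_measure k lam (\<lambda>x. case a x of H \<Rightarrow> h | L \<Rightarrow> l) \<mu>}"

end

theory Submission
  imports Defs
begin

text \<open>
  The theorem splits into a probabilistic part, valid for every \<open>k\<close>, and a polynomial system.

  Probability. A positive solution \<open>z\<close> of the functional equation makes the Gibbs measure a Markov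
  chain running down the tree: the children of an occupied vertex are vacant,
  and a vertex \<open>x\<close> with vacant parent is occupied with probability \<open>lam z\<^sub>x / (1 + lam z\<^sub>x)\<close>. Such a
  chain is built by thinning independent coin tosses on an infinite product space; that its cylinder
  probabilities are the \<open>finite_gibbs\<close> values, with \<open>Z\<^sub>n = \<Prod>x\<in>V\<^sub>n. 1 + lam z\<^sub>x\<close>, is the telescoping
  computation in \<open>prod_prob_proposals_for\<close>. Since cylinders determine a measure, there is exactly one
  Gibbs measure for each \<open>z\<close> (\<open>gibbs_measure_iff\<close>). Conversely
  the measure determines \<open>z\<close>: \<open>lam z\<^sub>x\<close> is the ratio of the probabilities of having a single particle at
  \<open>x\<close> and of having none, in a ball with \<open>x\<close> on its boundary (\<open>tree_gibbs_eq_iff\<close>). An arrangement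
  with \<open>m, r < k\<close> uses both symbols, so counting AGMs amounts to counting solutions \<open>(h, l)\<close> of the
  system, and an AGM is translation-invariant exactly when \<open>h = l\<close>.

  Algebra. Exchanging the two symbols reduces \<open>m = 0, r = 1\<close> to \<open>m = 1, r = 0\<close>. With \<open>u = lam h\<close> and
  \<open>v = lam l\<close> the two equations combine to \<open>(u - v) (1 - u v) = 0\<close>. The branch
  \<open>u = v\<close> is the unique TIGM. On the branch \<open>u v = 1\<close> the system becomes the cubic
  \<open>(1 + u)\<^sup>3 = lam u\<close>, whose positive roots number zero, one or two according to whether \<open>lam\<close> is below,
  at or above \<open>27 / 4\<close>, because \<open>(1 + u)\<^sup>3 / u\<close> has its minimum \<open>27 / 4\<close> at \<open>u = 1 / 2\<close>. The two
  branches meet only at \<open>u = v = 1\<close>, that is for \<open>lam = 8\<close>, where one of the two roots gives the TIGM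
  again.
\<close>

section \<open>Balls in the tree\<close>

lemma Cons_in_tree_vertices [simp]: "i # x \<in> tree_vertices k \<longleftrightarrow> i < k \<and> x \<in> tree_vertices k"
  by (auto simp: tree_vertices_def)

lemma Nil_in_tree_vertices [simp]: "[] \<in> tree_vertices k"
  by (auto simp: tree_vertices_def)

lemma succs_subset: "x \<in> tree_vertices k \<Longrightarrow> succs k x \<subseteq> tree_vertices k"
  by (auto simp: succs_def)

lemma Cons_in_succs [simp]: "i # x \<in> succs k y \<longleftrightarrow> i < k \<and> x = y"
  by (auto simp: succs_def)

lemma tree_ball_iff: "x \<in> tree_ball k n \<longleftrightarrow> x \<in> tree_vertices k \<and> length x \<le> n"
  by (auto simp: tree_ball_def level_def)

lemma tree_ball_0: "tree_ball k 0 = {[]}"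
  by (auto simp: tree_ball_iff)

lemma level_0: "level k 0 = {[]}"
  by (auto simp: level_def)

lemma tree_ball_Suc: "tree_ball k (Suc n) = tree_ball k n \<union> level k (Suc n)"
  by (auto simp: tree_ball_def atLeastAtMostSuc_conv)

lemma level_Suc: "level k (Suc n) = (\<Union>x\<in>level k n. succs k x)"
  by (auto simp: level_def succs_def length_Suc_conv)

lemma tree_ball_mono: "n \<le> n' \<Longrightarrow> tree_ball k n \<subseteq> tree_ball k n'"
  by (auto simp: tree_ball_iff)

lemma tree_ball_subset: "tree_ball k n \<subseteq> tree_vertices k"
  by (auto simp: tree_ball_iff)

lemma level_subset_tree_ball: "level k n \<subseteq> tree_ball k n"
  by (auto simp: tree_ball_def)

lemma finite_succs [simp]: "finite (succs k x)"
  by (auto simp: succs_def)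

lemma finite_level [simp]: "finite (level k n)"
  by (induction n) (auto simp: level_0 level_Suc)

lemma finite_tree_ball [simp]: "finite (tree_ball k n)"
  by (simp add: tree_ball_def)

lemma finite_subset_tree_ball:
  assumes "finite J" "J \<subseteq> tree_vertices k"
  obtains n where "J \<subseteq> tree_ball k n"
proof
  show "J \<subseteq> tree_ball k (Max (length ` J))"
    using assms by (auto simp: tree_ball_iff intro!: Max_ge)
qed

lemma prod_level_Suc:
  fixes f :: "nat list \<Rightarrow> 'a::comm_monoid_mult"
  shows "prod f (level k (Suc n)) = (\<Prod>x\<in>level k n. \<Prod>y\<in>succs k x. f y)"
  unfolding level_Suc by (rule prod.UNION_disjoint) (auto simp: succs_def)

lemma prod_tree_ball_Suc:
  fixes f :: "nat list \<Rightarrow> 'a::comm_monoid_mult"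
  shows "prod f (tree_ball k (Suc n)) = prod f (tree_ball k n) * prod f (level k (Suc n))"
  unfolding tree_ball_Suc
  by (rule prod.union_disjoint[OF finite_tree_ball finite_level]) (auto simp: tree_ball_iff level_def)

section \<open>Cylinder sets determine a measure on configurations\<close>

abbreviation cylinder :: "nat \<Rightarrow> nat \<Rightarrow> (nat list \<Rightarrow> nat) \<Rightarrow> (nat list \<Rightarrow> nat) set" where
  "cylinder k n \<sigma> \<equiv> {\<omega> \<in> configs k. restrict \<omega> (tree_ball k n) = \<sigma>}"

lemma admissibleD:
  assumes "\<sigma> \<in> admissible k A"
  shows "x \<in> A \<Longrightarrow> \<sigma> x \<in> {0, 1}" "x \<in> A \<Longrightarrow> y \<in> A \<Longrightarrow> y \<in> succs k x \<Longrightarrow> \<sigma> x = 1 \<Longrightarrow> \<sigma> y = 0"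
    "\<sigma> \<in> extensional A"
  using assms by (auto simp: admissible_def neighbours_def PiE_iff)

lemma finite_configs_upto [simp]: "finite (configs_upto k n)"
proof (rule finite_subset)
  show "configs_upto k n \<subseteq> (tree_ball k n \<rightarrow>\<^sub>E {0, 1})"
    by (auto simp: admissible_def)
qed (auto intro: finite_PiE)

lemma restrict_configs: "\<omega> \<in> configs k \<Longrightarrow> restrict \<omega> (tree_ball k n) \<in> configs_upto k n"
  using tree_ball_subset[of k n] by (auto simp: admissible_def PiE_iff subset_iff)

abbreviation full_space :: "nat \<Rightarrow> (nat list \<Rightarrow> nat) measure" where
  "full_space k \<equiv> PiM (tree_vertices k) (\<lambda>_. count_space {0, 1})"

lemma configs_subset_full_space: "configs k \<subseteq> space (full_space k)"
  by (auto simp: admissible_def space_PiM)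

lemma space_config_space: "space (config_space k) = configs k"
  using configs_subset_full_space[of k] by (auto simp: config_space_def space_restrict_space)

lemma sets_config_space_Int:
  "B \<in> sets (full_space k) \<Longrightarrow> configs k \<inter> B \<in> sets (config_space k)"
  by (auto simp: config_space_def sets_restrict_space)

lemma cylinder_in_sets: "{\<omega> \<in> configs k. \<forall>j\<in>J. \<omega> j \<in> X j} \<in> sets (config_space k)"
  if J: "J \<subseteq> tree_vertices k" "finite J"
proof -
  have "(\<lambda>\<omega>. \<omega> j) \<in> measurable (full_space k) (count_space {0, 1})" if "j \<in> J" for j
    using that J by (intro measurable_component_singleton) auto
  then have "(\<lambda>\<omega>. \<omega> j) -` (X j \<inter> {0, 1}) \<inter> space (full_space k) \<in> sets (full_space k)" if "j \<in> J" for j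
    using that by (intro measurable_sets[of _ _ "count_space {0, 1}"]) auto
  moreover have "(\<lambda>\<omega>. \<omega> j) -` (X j \<inter> {0, 1}) \<inter> space (full_space k) =
      {\<omega> \<in> space (full_space k). \<omega> j \<in> X j}" if "j \<in> J" for j
    using PiE_mem[of _ "tree_vertices k" "\<lambda>_. {0, 1}" j] J(1) that
    unfolding space_PiM space_count_space by blast
  ultimately have "{\<omega> \<in> space (full_space k). \<forall>j\<in>J. \<omega> j \<in> X j} \<in> sets (full_space k)"
    by (intro sets.sets_Collect_finite_All J(2)) simp
  then have "configs k \<inter> {\<omega> \<in> space (full_space k). \<forall>j\<in>J. \<omega> j \<in> X j} \<in> sets (config_space k)"
    by (rule sets_config_space_Int)
  moreover have "configs k \<inter> {\<omega> \<in> space (full_space k). \<forall>j\<in>J. \<omega> j \<in> X j} =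
      {\<omega> \<in> configs k. \<forall>j\<in>J. \<omega> j \<in> X j}"
    using configs_subset_full_space[of k] by blast
  ultimately show ?thesis by (simp only:)
qed

lemma cylinder_measurable [simp]: "cylinder k n \<sigma> \<in> sets (config_space k)"
proof (cases "\<sigma> \<in> extensional (tree_ball k n)")
  case True
  then have "cylinder k n \<sigma> = {\<omega> \<in> configs k. \<forall>j\<in>tree_ball k n. \<omega> j \<in> {\<sigma> j}}"
    by (auto simp: restrict_def extensional_def fun_eq_iff)
  then show ?thesis
    using cylinder_in_sets[of "tree_ball k n" k "\<lambda>j. {\<sigma> j}"] tree_ball_subset by simp
next
  case False
  then have "cylinder k n \<sigma> = {}" by auto
  then show ?thesis by (metis sets.empty_sets)
qed

lemma measure_eq_sum_cylinders:
  assumes "finite_measure \<mu>" "sets \<mu> = sets (config_space k)" "J \<subseteq> tree_ball k n"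
  shows "measure \<mu> {\<omega> \<in> configs k. \<forall>j\<in>J. \<omega> j \<in> X j} =
    (\<Sum>\<sigma> | \<sigma> \<in> configs_upto k n \<and> (\<forall>j\<in>J. \<sigma> j \<in> X j). measure \<mu> (cylinder k n \<sigma>))"
proof -
  interpret finite_measure \<mu> by fact
  let ?S = "{\<sigma> \<in> configs_upto k n. \<forall>j\<in>J. \<sigma> j \<in> X j}"
  have "{\<omega> \<in> configs k. \<forall>j\<in>J. \<omega> j \<in> X j} = (\<Union>\<sigma>\<in>?S. cylinder k n \<sigma>)"
    by (auto simp: restrict_configs subsetD[OF assms(3)])
  moreover have "measure \<mu> (\<Union>\<sigma>\<in>?S. cylinder k n \<sigma>) = (\<Sum>\<sigma>\<in>?S. measure \<mu> (cylinder k n \<sigma>))"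
    by (intro finite_measure_finite_Union) (auto simp: assms disjoint_family_on_def)
  ultimately show ?thesis by (simp only:)
qed

text \<open>
  The sets that fix the values at finitely many sites generate the \<open>\<sigma>\<close>-algebra and are stable under
  intersection, and each is a finite disjoint union of cylinders over a ball that contains these
  sites. The measures are pushed forward to the whole product space, where the uniqueness theorem for
  infinite products applies.
\<close>

lemma measure_eqI_cylinders:
  assumes "finite_measure \<mu>" "finite_measure \<nu>"
    and sets: "sets \<mu> = sets (config_space k)" "sets \<nu> = sets (config_space k)"
    and eq: "\<And>n \<sigma>. \<sigma> \<in> configs_upto k n \<Longrightarrow> measure \<mu> (cylinder k n \<sigma>) = measure \<nu> (cylinder k n \<sigma>)"
  shows "\<mu> = \<nu>"
proof -
  interpret \<mu>: finite_measure \<mu> by fact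
  interpret \<nu>: finite_measure \<nu> by fact
  have space: "space \<mu> = configs k" "space \<nu> = configs k"
    using sets[THEN sets_eq_imp_space_eq] by (simp_all add: space_config_space)
  have id: "(\<lambda>\<omega>. \<omega>) \<in> measurable M (full_space k)" if "sets M = sets (config_space k)" for M
    using measurable_cong_sets[OF that refl, of "full_space k"]
    by (simp add: config_space_def measurable_restrict_space1)
  let ?D = "\<lambda>M. distr M (full_space k) (\<lambda>\<omega>. \<omega>)"
  have "?D \<mu> = ?D \<nu>"
  proof (rule measure_eqI_PiM_infinite)
    fix X :: "nat list \<Rightarrow> nat set" and J
    assume J: "finite J" "J \<subseteq> tree_vertices k"
      and X: "\<And>j. j \<in> J \<Longrightarrow> X j \<in> sets (count_space {0, 1})"
    obtain n where n: "J \<subseteq> tree_ball k n"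
      using finite_subset_tree_ball[OF J] .
    let ?E = "prod_emb (tree_vertices k) (\<lambda>_. count_space {0, 1}) J (Pi\<^sub>E J X)"
    have E: "?E \<in> sets (full_space k)"
      using J X by (intro sets_PiM_I) auto
    have "?E \<inter> configs k = {\<omega> \<in> configs k. \<forall>j\<in>J. \<omega> j \<in> X j}"
    proof (intro set_eqI iffI)
      fix \<omega> assume "\<omega> \<in> ?E \<inter> configs k"
      then show "\<omega> \<in> {\<omega> \<in> configs k. \<forall>j\<in>J. \<omega> j \<in> X j}"
        by (simp add: prod_emb_iff PiE_iff)
    next
      fix \<omega> assume *: "\<omega> \<in> {\<omega> \<in> configs k. \<forall>j\<in>J. \<omega> j \<in> X j}"
      then have "\<omega> \<in> tree_vertices k \<rightarrow>\<^sub>E {0, 1}"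
        by (simp add: admissible_def)
      with * show "\<omega> \<in> ?E \<inter> configs k"
        by (simp add: prod_emb_iff PiE_iff)
    qed
    then have "emeasure (?D M) ?E = emeasure M {\<omega> \<in> configs k. \<forall>j\<in>J. \<omega> j \<in> X j}"
      if "sets M = sets (config_space k)" for M
      using emeasure_distr[OF id[OF that] E] sets_eq_imp_space_eq[OF that]
      by (simp only: space_config_space vimage_ident)
    moreover have "measure \<mu> {\<omega> \<in> configs k. \<forall>j\<in>J. \<omega> j \<in> X j} =
        measure \<nu> {\<omega> \<in> configs k. \<forall>j\<in>J. \<omega> j \<in> X j}"
      unfolding measure_eq_sum_cylinders[OF assms(1) sets(1) n]
        measure_eq_sum_cylinders[OF assms(2) sets(2) n]
      by (rule sum.cong[OF refl]) (simp add: eq)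
    ultimately show "emeasure (?D \<mu>) ?E = emeasure (?D \<nu>) ?E"
      using sets by (simp only: \<mu>.emeasure_eq_measure \<nu>.emeasure_eq_measure)
  qed (simp_all only: sets_distr \<mu>.finite_measure_distr[OF id[OF sets(1)]])
  show "\<mu> = \<nu>"
  proof (rule measure_eqI)
    fix B assume "B \<in> sets \<mu>"
    then obtain B' where B: "B' \<in> sets (full_space k)" "B = configs k \<inter> B'"
      unfolding sets config_space_def by (auto simp: sets_restrict_space)
    have "emeasure (?D \<mu>) B' = emeasure (?D \<nu>) B'"
      using \<open>?D \<mu> = ?D \<nu>\<close> by simp
    then show "emeasure \<mu> B = emeasure \<nu> B"
      using B(1) by (simp only: B(2) emeasure_distr[OF id[OF sets(1)]]
          emeasure_distr[OF id[OF sets(2)]] space vimage_ident Int_commute)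
  qed (simp add: sets)
qed

section \<open>The Gibbs measure as a thinning of independent coin tosses\<close>

text \<open>
  Each vertex \<open>x\<close> proposes independently, with the coin \<open>b x\<close>, to be occupied; the proposal is accepted
  when the parent is vacant.
\<close>

fun occupied :: "(nat list \<Rightarrow> bool) \<Rightarrow> nat list \<Rightarrow> bool" where
  "occupied b [] = b []"
| "occupied b (i # x) = (b (i # x) \<and> \<not> occupied b x)"

definition thinning :: "nat \<Rightarrow> (nat list \<Rightarrow> bool) \<Rightarrow> nat list \<Rightarrow> nat" where
  "thinning k b = (\<lambda>x\<in>tree_vertices k. of_bool (occupied b x))"

text \<open>
  The outcomes of the coin at a vertex that are compatible with the configuration \<open>\<sigma>\<close>: below an occupied
  parent the coin is ignored.
\<close>

fun proposals_for :: "(nat list \<Rightarrow> nat) \<Rightarrow> nat list \<Rightarrow> bool set" where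
  "proposals_for \<sigma> [] = {\<sigma> [] = 1}"
| "proposals_for \<sigma> (i # x) = (if \<sigma> x = 1 then UNIV else {\<sigma> (i # x) = 1})"

text \<open>
  Conditionally on a vacant parent, occupying \<open>x\<close> has weight \<open>lam z\<^sub>x\<close> against weight \<open>1\<close> for leaving it
  vacant.
\<close>

definition proposal_pmf :: "real \<Rightarrow> (nat list \<Rightarrow> real) \<Rightarrow> nat list \<Rightarrow> bool pmf" where
  "proposal_pmf lam z x = bernoulli_pmf (lam * z x / (1 + lam * z x))"

abbreviation proposal_space :: "nat \<Rightarrow> real \<Rightarrow> (nat list \<Rightarrow> real) \<Rightarrow> (nat list \<Rightarrow> bool) measure" where
  "proposal_space k lam z \<equiv> PiM (tree_vertices k) (\<lambda>x. measure_pmf (proposal_pmf lam z x))"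

definition tree_gibbs :: "nat \<Rightarrow> real \<Rightarrow> (nat list \<Rightarrow> real) \<Rightarrow> (nat list \<Rightarrow> nat) measure" where
  "tree_gibbs k lam z = distr (proposal_space k lam z) (config_space k) (thinning k)"

lemma thinning_in_configs: "thinning k b \<in> configs k"
  by (auto simp: thinning_def admissible_def neighbours_def succs_def)

lemma occupied_measurable:
  "x \<in> tree_vertices k \<Longrightarrow> Measurable.pred (proposal_space k lam z) (\<lambda>b. occupied b x)"
proof (induction x)
  case Nil
  have "(\<lambda>b. b []) \<in> measurable (proposal_space k lam z) (measure_pmf (proposal_pmf lam z []))"
    by (rule measurable_component_singleton) simp
  then show ?case by simp
next
  case (Cons i x)
  have "(\<lambda>b. b (i # x)) \<in> measurable (proposal_space k lam z) (measure_pmf (proposal_pmf lam z (i # x)))"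
    by (rule measurable_component_singleton) (use Cons.prems in simp)
  then have "Measurable.pred (proposal_space k lam z) (\<lambda>b. b (i # x))" by simp
  moreover have "Measurable.pred (proposal_space k lam z) (\<lambda>b. occupied b x)"
    using Cons by simp
  ultimately show ?case by simp
qed

lemma thinning_measurable: "thinning k \<in> measurable (proposal_space k lam z) (config_space k)"
  unfolding config_space_def
proof (rule measurable_restrict_space2)
  have "(\<lambda>b. of_bool (occupied b x)) \<in> measurable (proposal_space k lam z) (count_space {0, 1 :: nat})"
    if "x \<in> tree_vertices k" for x
    by (rule measurable_compose[OF occupied_measurable[OF that]]) auto
  then show "thinning k \<in> measurable (proposal_space k lam z) (full_space k)"
    unfolding thinning_def by (rule measurable_restrict)
qed (auto intro: thinning_in_configs)

lemma sets_tree_gibbs: "sets (tree_gibbs k lam z) = sets (config_space k)"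
  by (simp add: tree_gibbs_def)

lemma prob_space_tree_gibbs: "prob_space (tree_gibbs k lam z)"
proof -
  interpret prob_space "proposal_space k lam z"
    by (intro prob_space_PiM prob_space_measure_pmf)
  show ?thesis
    unfolding tree_gibbs_def by (rule prob_space_distr[OF thinning_measurable])
qed

text \<open>
  This turns a cylinder into a product event: the coins in the ball are constrained one by one. Towards
  the product event one compares with the parent; towards the cylinder one argues by recursion from the
  root, and admissibility of \<open>\<sigma>\<close> settles the vertices below an occupied one.
\<close>

lemma thinning_eq_iff:
  assumes \<sigma>: "\<sigma> \<in> configs_upto k n"
  shows "restrict (thinning k b) (tree_ball k n) = \<sigma> \<longleftrightarrow> (\<forall>x\<in>tree_ball k n. b x \<in> proposals_for \<sigma> x)"
proof -
  have "restrict (thinning k b) (tree_ball k n) = \<sigma> \<longleftrightarrow>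
      (\<forall>x\<in>tree_ball k n. of_bool (occupied b x) = \<sigma> x)"
    using admissibleD(3)[OF \<sigma>] tree_ball_subset[of k n]
    by (auto simp: thinning_def fun_eq_iff extensional_def restrict_def subset_iff)
  also have "\<dots> \<longleftrightarrow> (\<forall>x\<in>tree_ball k n. b x \<in> proposals_for \<sigma> x)"
  proof (intro iffI ballI)
    fix x assume eq: "\<forall>x\<in>tree_ball k n. of_bool (occupied b x) = \<sigma> x" and x: "x \<in> tree_ball k n"
    show "b x \<in> proposals_for \<sigma> x"
    proof (cases x)
      case Nil
      then show ?thesis using eq x by (cases "b []") auto
    next
      case (Cons i y)
      then have "y \<in> tree_ball k n" using x by (simp add: tree_ball_iff)
      then have "of_bool (occupied b y) = \<sigma> y" "of_bool (occupied b x) = \<sigma> x"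
        using eq x by blast+
      then show ?thesis using Cons by (cases "occupied b y"; cases "occupied b x") auto
    qed
  next
    fix x assume all: "\<forall>x\<in>tree_ball k n. b x \<in> proposals_for \<sigma> x"
    assume "x \<in> tree_ball k n"
    then show "of_bool (occupied b x) = \<sigma> x"
    proof (induction x)
      case Nil
      then show ?case using all admissibleD(1)[OF \<sigma>, of "[]"] by force
    next
      case (Cons i y)
      then have y: "y \<in> tree_ball k n" "i < k" by (simp_all add: tree_ball_iff)
      have b: "b (i # y) \<in> proposals_for \<sigma> (i # y)" using all Cons.prems by blast
      have s: "\<sigma> (i # y) \<in> {0, 1}" "\<sigma> y = 1 \<Longrightarrow> \<sigma> (i # y) = 0"
        using admissibleD(1)[OF \<sigma> Cons.prems] admissibleD(2)[OF \<sigma> y(1) Cons.prems] y(2) by simp_all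
      show ?case using Cons.IH[OF y(1)] b s by (cases "occupied b y") (auto split: if_splits)
    qed
  qed
  finally show ?thesis .
qed

text \<open>
  Clearing the denominator isolates the factors that will make up \<open>partition_function\<close>.
\<close>

lemma prob_proposals_for:
  assumes "lam * z x > 0" "\<sigma> x \<in> {0, 1}"
  shows "measure_pmf.prob (proposal_pmf lam z x) (proposals_for \<sigma> x) * (1 + lam * z x) =
    (if \<exists>i y. x = i # y \<and> \<sigma> y = 1 then 1 + lam * z x else (lam * z x) ^ \<sigma> x)"
proof -
  define p where "p = lam * z x / (1 + lam * z x)"
  have "0 \<le> p" "p \<le> 1" "p * (1 + lam * z x) = lam * z x" "(1 - p) * (1 + lam * z x) = 1"
    using assms(1) by (simp_all add: p_def field_simps)
  then have "measure_pmf.prob (proposal_pmf lam z x) {\<sigma> x = 1} * (1 + lam * z x) = (lam * z x) ^ \<sigma> x"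
    using assms(2) by (auto simp: proposal_pmf_def p_def[symmetric] measure_pmf_single)
  then show ?thesis by (cases x) auto
qed

lemma hc_weight_eq_prod:
  assumes "\<forall>x\<in>tree_ball k n. \<sigma> x \<in> {0, 1}"
  shows "hc_weight k lam z n \<sigma> =
    (\<Prod>x\<in>tree_ball k n. lam ^ \<sigma> x) * (\<Prod>x\<in>level k n. z x ^ \<sigma> x)"
proof -
  have "(\<Prod>x\<in>tree_ball k n. lam ^ \<sigma> x) = (\<Prod>x\<in>tree_ball k n. if \<sigma> x = 1 then lam else 1)"
    using assms by (intro prod.cong) auto
  also have "\<dots> = lam ^ card {x \<in> tree_ball k n. \<sigma> x = 1}"
    by (simp add: prod.If_cases Int_def)
  finally have 1: "(\<Prod>x\<in>tree_ball k n. lam ^ \<sigma> x) = lam ^ card {x \<in> tree_ball k n. \<sigma> x = 1}" .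
  have "(\<Prod>x\<in>level k n. boundary_factor z (\<sigma> x) x) = (\<Prod>x\<in>level k n. z x ^ \<sigma> x)"
  proof (rule prod.cong[OF refl])
    fix x assume "x \<in> level k n"
    then have "\<sigma> x \<in> {0, 1}" using assms level_subset_tree_ball[of k n] by blast
    then show "boundary_factor z (\<sigma> x) x = z x ^ \<sigma> x" by (auto simp: boundary_factor_def)
  qed
  with 1 show ?thesis by (simp add: hc_weight_def)
qed

text \<open>
  Induction over the levels, with the denominator multiplied out. Passing from \<open>V\<^sub>n\<close> to
  \<open>V\<^bsub>n+1\<^esub>\<close> multiplies the left side by the factors of the new vertices, while on the right the boundary weights \<open>z\<^sub>x\<close> of the old sphere have to disappear. They
  do so by the functional equation: for an occupied \<open>x\<close> the children are vacant and contribute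
  \<open>\<Prod>y. 1 + lam z\<^sub>y\<close>, which is \<open>1 / z\<^sub>x\<close>; for a vacant \<open>x\<close> the weight is \<open>1\<close> and the children contribute
  exactly their own weights.
\<close>

lemma prod_prob_proposals_for:
  assumes lam: "lam > 0" and z: "hc_solution k lam z" and \<sigma>: "\<sigma> \<in> configs_upto k n"
  shows "(\<Prod>x\<in>tree_ball k n. measure_pmf.prob (proposal_pmf lam z x) (proposals_for \<sigma> x)) =
    hc_weight k lam z n \<sigma> / (\<Prod>x\<in>tree_ball k n. 1 + lam * z x)"
proof -
  have pos: "lam * z x > 0" if "x \<in> tree_vertices k" for x
    using lam z that by (auto simp: hc_solution_def)
  have s: "\<sigma> x \<in> {0, 1}" if "x \<in> tree_ball k n" for x
    using admissibleD(1)[OF \<sigma> that] .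
  define q where "q x = measure_pmf.prob (proposal_pmf lam z x) (proposals_for \<sigma> x) * (1 + lam * z x)" for x
  have q: "q x = (if \<exists>i y. x = i # y \<and> \<sigma> y = 1 then 1 + lam * z x else (lam * z x) ^ \<sigma> x)"
    if "x \<in> tree_ball k n" for x
    unfolding q_def by (rule prob_proposals_for) (use that s pos in \<open>auto simp: tree_ball_iff\<close>)
  have "n' \<le> n \<Longrightarrow> prod q (tree_ball k n') = hc_weight k lam z n' \<sigma>" for n'
  proof (induction n')
    case 0
    have "[] \<in> tree_ball k n" by (simp add: tree_ball_iff)
    then have "q [] = (lam * z []) ^ \<sigma> []" using q by simp
    then show ?case
      using s[OF \<open>[] \<in> tree_ball k n\<close>] by (auto simp: hc_weight_eq_prod tree_ball_0 level_0)
  next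
    case (Suc n')
    have sub: "tree_ball k n' \<subseteq> tree_ball k n" "tree_ball k (Suc n') \<subseteq> tree_ball k n"
      using Suc.prems by (auto intro!: tree_ball_mono)
    have step: "z x ^ \<sigma> x * (\<Prod>y\<in>succs k x. q y) = (\<Prod>y\<in>succs k x. lam ^ \<sigma> y * z y ^ \<sigma> y)"
      if x: "x \<in> level k n'" for x
    proof -
      have xV: "x \<in> tree_vertices k" and xn: "x \<in> tree_ball k n"
        using x Suc.prems by (auto simp: level_def tree_ball_iff)
      have yn: "y \<in> tree_ball k n" "y \<in> tree_vertices k" if "y \<in> succs k x" for y
        using that x Suc.prems by (auto simp: level_def tree_ball_iff succs_def)
      show ?thesis
      proof (cases "\<sigma> x = 1")
        case True
        have "z x = (\<Prod>y\<in>succs k x. inverse (1 + lam * z y))"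
          using z xV by (simp add: hc_solution_def)
        moreover have "(\<Prod>y\<in>succs k x. q y) = (\<Prod>y\<in>succs k x. 1 + lam * z y)"
          using yn True by (intro prod.cong refl) (auto simp: q succs_def)
        ultimately have "z x * (\<Prod>y\<in>succs k x. q y) =
            (\<Prod>y\<in>succs k x. inverse (1 + lam * z y) * (1 + lam * z y))"
          by (simp only: prod.distrib)
        also have "\<dots> = 1"
        proof (rule prod.neutral, rule ballI)
          fix y assume "y \<in> succs k x"
          then show "inverse (1 + lam * z y) * (1 + lam * z y) = 1"
            using pos[OF yn(2), of y] by (intro left_inverse) simp
        qed
        also have "1 = (\<Prod>y\<in>succs k x. lam ^ \<sigma> y * z y ^ \<sigma> y)"
          using admissibleD(2)[OF \<sigma> xn yn(1) _ True] by simp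
        finally show ?thesis using True by simp
      next
        case False
        then have "\<sigma> x = 0" using s[OF xn] by simp
        moreover have "(\<Prod>y\<in>succs k x. q y) = (\<Prod>y\<in>succs k x. lam ^ \<sigma> y * z y ^ \<sigma> y)"
          using yn \<open>\<sigma> x = 0\<close> by (intro prod.cong refl) (auto simp: q succs_def power_mult_distrib)
        ultimately show ?thesis by simp
      qed
    qed
    have "prod q (tree_ball k (Suc n')) =
        hc_weight k lam z n' \<sigma> * (\<Prod>x\<in>level k n'. \<Prod>y\<in>succs k x. q y)"
      using Suc by (simp add: prod_tree_ball_Suc prod_level_Suc)
    also have "\<dots> = (\<Prod>x\<in>tree_ball k n'. lam ^ \<sigma> x) *
        (\<Prod>x\<in>level k n'. z x ^ \<sigma> x * (\<Prod>y\<in>succs k x. q y))"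
      using s sub by (subst hc_weight_eq_prod) (auto simp: prod.distrib)
    also have "\<dots> = (\<Prod>x\<in>tree_ball k n'. lam ^ \<sigma> x) *
        (\<Prod>x\<in>level k n'. \<Prod>y\<in>succs k x. lam ^ \<sigma> y * z y ^ \<sigma> y)"
      by (simp add: step)
    also have "\<dots> = (\<Prod>x\<in>tree_ball k (Suc n'). lam ^ \<sigma> x) * (\<Prod>x\<in>level k (Suc n'). z x ^ \<sigma> x)"
      by (simp add: prod_tree_ball_Suc prod_level_Suc[symmetric] prod.distrib)
    also have "\<dots> = hc_weight k lam z (Suc n') \<sigma>"
      using s sub by (subst hc_weight_eq_prod) auto
    finally show ?case .
  qed
  from this[of n] have "(\<Prod>x\<in>tree_ball k n. measure_pmf.prob (proposal_pmf lam z x) (proposals_for \<sigma> x)) *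
      (\<Prod>x\<in>tree_ball k n. 1 + lam * z x) = hc_weight k lam z n \<sigma>"
    by (simp add: q_def prod.distrib)
  moreover have "(\<Prod>x\<in>tree_ball k n. 1 + lam * z x) > 0"
    using pos by (intro prod_pos) (auto simp: tree_ball_iff intro: add_pos_pos)
  then have "(\<Prod>x\<in>tree_ball k n. 1 + lam * z x) \<noteq> 0"
    by (rule less_imp_neq[symmetric])
  ultimately show ?thesis by (rule nonzero_eq_divide_eq[THEN iffD2, rotated])
qed

lemma measure_tree_gibbs_cylinder:
  assumes "lam > 0" "hc_solution k lam z" "\<sigma> \<in> configs_upto k n"
  shows "measure (tree_gibbs k lam z) (cylinder k n \<sigma>) =
    hc_weight k lam z n \<sigma> / (\<Prod>x\<in>tree_ball k n. 1 + lam * z x)"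
proof -
  let ?P = "proposal_space k lam z"
  interpret product_prob_space "\<lambda>x. measure_pmf (proposal_pmf lam z x)" "tree_vertices k"
    by unfold_locales
  have "thinning k -` cylinder k n \<sigma> \<inter> space ?P =
      {b \<in> space ?P. \<forall>x\<in>tree_ball k n. b x \<in> proposals_for \<sigma> x}"
    using thinning_eq_iff[OF assms(3)] thinning_in_configs by blast
  moreover have "{b \<in> space ?P. \<forall>x\<in>tree_ball k n. b x \<in> proposals_for \<sigma> x} =
      prod_emb (tree_vertices k) (\<lambda>x. measure_pmf (proposal_pmf lam z x))
      (tree_ball k n) (Pi\<^sub>E (tree_ball k n) (proposals_for \<sigma>))"
    by (auto simp: prod_emb_iff space_PiM PiE_iff)
  moreover have "measure ?P (prod_emb (tree_vertices k) (\<lambda>x. measure_pmf (proposal_pmf lam z x))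
      (tree_ball k n) (Pi\<^sub>E (tree_ball k n) (proposals_for \<sigma>))) =
      (\<Prod>x\<in>tree_ball k n. measure_pmf.prob (proposal_pmf lam z x) (proposals_for \<sigma> x))"
    by (rule measure_PiM_emb[OF tree_ball_subset]) simp_all
  moreover have "measure (tree_gibbs k lam z) (cylinder k n \<sigma>) =
      measure ?P (thinning k -` cylinder k n \<sigma> \<inter> space ?P)"
    unfolding tree_gibbs_def by (rule measure_distr[OF thinning_measurable cylinder_measurable])
  ultimately show ?thesis
    using prod_prob_proposals_for[OF assms] by (simp only:)
qed

text \<open>
  The cylinder probabilities over a ball add up to \<open>1\<close>, so the normalizing constant can be read off without
  summing the weights.
\<close>

lemma partition_function_eq:
  assumes "lam > 0" "hc_solution k lam z"
  shows "partition_function k lam z n = (\<Prod>x\<in>tree_ball k n. 1 + lam * z x)"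
    and "partition_function k lam z n > 0"
proof -
  interpret prob_space "tree_gibbs k lam z" by (rule prob_space_tree_gibbs)
  let ?Z = "\<Prod>x\<in>tree_ball k n. 1 + lam * z x"
  have "?Z > 0"
    using assms by (intro prod_pos) (auto simp: tree_ball_iff hc_solution_def intro!: add_pos_pos)
  have "space (tree_gibbs k lam z) = configs k"
    by (simp add: tree_gibbs_def space_config_space)
  then have "1 = measure (tree_gibbs k lam z) (configs k)"
    using prob_space by simp
  also have "measure (tree_gibbs k lam z) (configs k) =
      (\<Sum>\<sigma>\<in>configs_upto k n. measure (tree_gibbs k lam z) (cylinder k n \<sigma>))"
    using measure_eq_sum_cylinders[OF finite_measure_axioms sets_tree_gibbs, of "{}" n] by simp
  also have "\<dots> = partition_function k lam z n / ?Z"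
    using assms by (simp add: measure_tree_gibbs_cylinder partition_function_def sum_divide_distrib)
  finally show "partition_function k lam z n = ?Z" using \<open>?Z > 0\<close> by (simp add: field_simps)
  with \<open>?Z > 0\<close> show "partition_function k lam z n > 0" by simp
qed

lemma gibbs_measure_iff:
  assumes "lam > 0" "hc_solution k lam z"
  shows "gibbs_measure k lam z \<mu> \<longleftrightarrow> \<mu> = tree_gibbs k lam z"
proof
  have *: "gibbs_measure k lam z (tree_gibbs k lam z)"
    using assms prob_space_tree_gibbs sets_tree_gibbs
    by (auto simp: gibbs_measure_def finite_gibbs_def measure_tree_gibbs_cylinder partition_function_eq(1))
  then show "\<mu> = tree_gibbs k lam z \<Longrightarrow> gibbs_measure k lam z \<mu>" by simp
  assume "gibbs_measure k lam z \<mu>"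
  with * show "\<mu> = tree_gibbs k lam z"
    by (intro measure_eqI_cylinders[where k = k])
       (auto simp: gibbs_measure_def prob_space_def)
qed

section \<open>A Gibbs measure determines the function z\<close>

text \<open>
  In the ball with \<open>x\<close> on its boundary sphere, the configuration with a particle only at \<open>x\<close> has
  weight \<open>lam z\<^sub>x\<close> and the empty configuration has weight \<open>1\<close>; the normalizing constant cancels.
\<close>

lemma activity_eq_cylinder_ratio:
  assumes lam: "lam > 0" and \<mu>: "gibbs_measure k lam z \<mu>" and x: "x \<in> tree_vertices k"
  defines "B \<equiv> tree_ball k (length x)"
  shows "lam * z x = measure \<mu> (cylinder k (length x) (\<lambda>y\<in>B. of_bool (y = x))) /
    measure \<mu> (cylinder k (length x) (\<lambda>y\<in>B. 0))"
proof -
  define n where "n = length x"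
  have xB: "x \<in> level k n" "x \<in> B" using x by (auto simp: B_def level_def tree_ball_iff n_def)
  have adm: "(\<lambda>y\<in>B. 0) \<in> configs_upto k n" "(\<lambda>y\<in>B. of_bool (y = x)) \<in> configs_upto k n"
    by (auto simp: admissible_def B_def n_def neighbours_def succs_def)
  have sol: "hc_solution k lam z" using \<mu> by (simp add: gibbs_measure_def)
  have w0: "hc_weight k lam z n (\<lambda>y\<in>B. 0) = 1"
    using level_subset_tree_ball[of k n] by (subst hc_weight_eq_prod) (auto simp: B_def n_def subset_iff)
  have "(\<Prod>y\<in>level k n. z y ^ (\<lambda>y\<in>B. of_bool (y = x)) y) = (\<Prod>y\<in>level k n. if y = x then z x else 1)"
    using level_subset_tree_ball[of k n] by (intro prod.cong) (auto simp: B_def n_def subset_iff)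
  also have "\<dots> = z x" using xB(1) by simp
  finally have 1: "(\<Prod>y\<in>level k n. z y ^ (\<lambda>y\<in>B. of_bool (y = x)) y) = z x" .
  have "(\<Prod>y\<in>tree_ball k n. lam ^ (\<lambda>y\<in>B. of_bool (y = x)) y) = (\<Prod>y\<in>tree_ball k n. if y = x then lam else 1)"
    by (intro prod.cong) (auto simp: B_def n_def)
  also have "\<dots> = lam" using xB(2) by (simp add: B_def n_def)
  finally have w1: "hc_weight k lam z n (\<lambda>y\<in>B. of_bool (y = x)) = lam * z x"
    using 1 by (subst hc_weight_eq_prod) (auto simp: B_def n_def)
  show ?thesis
    using \<mu> adm w0 w1 partition_function_eq(2)[OF lam sol, of n]
    by (auto simp: gibbs_measure_def finite_gibbs_def n_def[symmetric])
qed

lemma tree_gibbs_eq_iff: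
  assumes "lam > 0" "hc_solution k lam z" "hc_solution k lam z'"
  shows "tree_gibbs k lam z = tree_gibbs k lam z' \<longleftrightarrow> (\<forall>x\<in>tree_vertices k. z x = z' x)"
proof
  assume eq: "tree_gibbs k lam z = tree_gibbs k lam z'"
  show "\<forall>x\<in>tree_vertices k. z x = z' x"
  proof
    fix x assume x: "x \<in> tree_vertices k"
    have "gibbs_measure k lam z (tree_gibbs k lam z)" "gibbs_measure k lam z' (tree_gibbs k lam z)"
      using assms eq by (simp_all add: gibbs_measure_iff)
    from this[THEN activity_eq_cylinder_ratio[OF assms(1) _ x]]
    have "lam * z x = lam * z' x" by (simp only:)
    then show "z x = z' x" using assms(1) by simp
  qed
next
  assume eq: "\<forall>x\<in>tree_vertices k. z x = z' x"
  then have "proposal_space k lam z = proposal_space k lam z'"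
    by (intro PiM_cong) (simp_all add: proposal_pmf_def)
  then show "tree_gibbs k lam z = tree_gibbs k lam z'"
    by (simp add: tree_gibbs_def)
qed

section \<open>Translation-invariant Gibbs measures\<close>

lemma hc_solution_const_iff: "hc_solution k lam (\<lambda>_. c) \<longleftrightarrow> c > 0 \<and> c = 1 / (1 + lam * c) ^ k"
proof -
  have "card (succs k x) = k" for x
    by (simp add: succs_def card_image inj_on_def)
  then have "(\<Prod>y\<in>succs k x. inverse (1 + lam * c)) = 1 / (1 + lam * c) ^ k" for x
    by (simp add: power_inverse inverse_eq_divide power_one_over)
  then show ?thesis
    unfolding hc_solution_def using Nil_in_tree_vertices[of k]
    by (simp only:) blast
qed

text \<open>
  The equation reads \<open>c (1 + lam c)\<^sup>k = 1\<close>, whose left side increases strictly from \<open>0\<close> at \<open>c = 0\<close>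
  to at least \<open>1\<close> at \<open>c = 1\<close>.
\<close>

lemma ex1_hc_solution_const:
  assumes "lam > 0"
  shows "\<exists>!c. hc_solution k lam (\<lambda>_. c)"
proof -
  define f where "f c = c * (1 + lam * c) ^ k" for c
  have f_less: "f c < f c'" if "0 \<le> c" "c < c'" for c c'
  proof -
    have "0 < 1 + lam * c" "1 + lam * c \<le> 1 + lam * c'"
      using that assms by (simp_all add: add_pos_nonneg)
    then have "0 < (1 + lam * c) ^ k" "(1 + lam * c) ^ k \<le> (1 + lam * c') ^ k"
      by (simp_all add: power_mono)
    then show ?thesis
      unfolding f_def using that by (intro mult_less_le_imp_less) auto
  qed
  have iff: "hc_solution k lam (\<lambda>_. c) \<longleftrightarrow> c > 0 \<and> f c = 1" for c
  proof (cases "c > 0")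
    case True
    then have "1 + lam * c > 0" using assms by (simp add: add_pos_pos)
    then have "(1 + lam * c) ^ k \<noteq> 0" by simp
    then show ?thesis
      unfolding hc_solution_const_iff f_def by (simp add: nonzero_eq_divide_eq)
  qed (simp add: hc_solution_const_iff)
  have "\<exists>c\<ge>0. c \<le> 1 \<and> f c = 1"
  proof (rule IVT')
    show "1 \<le> f 1" unfolding f_def using assms by (simp add: one_le_power)
    show "continuous_on {0..1} f" unfolding f_def by (intro continuous_intros)
  qed (simp_all add: f_def)
  then obtain c where c: "c \<ge> 0" "f c = 1" by blast
  then have "c \<noteq> 0" by (auto simp: f_def)
  show ?thesis
  proof (rule ex1I)
    show "hc_solution k lam (\<lambda>_. c)" using c \<open>c \<noteq> 0\<close> iff by simp
    fix c' assume "hc_solution k lam (\<lambda>_. c')"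
    then have "c' > 0" "f c' = 1" using iff by blast+
    then show "c' = c" using c f_less[of c c'] f_less[of c' c] by (cases c c' rule: linorder_cases) auto
  qed
qed

lemma TIGMs_eq:
  assumes "lam > 0" "hc_solution k lam (\<lambda>_. c)"
  shows "TIGMs k lam = {tree_gibbs k lam (\<lambda>_. c)}"
proof (intro equalityI subsetI)
  fix \<mu> assume "\<mu> \<in> TIGMs k lam"
  then obtain z c' where z: "\<forall>x\<in>tree_vertices k. z x = c'" "gibbs_measure k lam z \<mu>"
    by (auto simp: TIGMs_def)
  then have sol: "hc_solution k lam z" by (simp add: gibbs_measure_def)
  moreover have "(\<Prod>y\<in>succs k x. inverse (1 + lam * z y)) = (\<Prod>y\<in>succs k x. inverse (1 + lam * c'))"
    if "x \<in> tree_vertices k" for x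
    using z(1) succs_subset[OF that] by (intro prod.cong) auto
  ultimately have "hc_solution k lam (\<lambda>_. c')"
    using z(1) by (auto simp: hc_solution_def)
  then have "c' = c" using ex1_hc_solution_const[OF assms(1)] assms(2) by blast
  then have "tree_gibbs k lam z = tree_gibbs k lam (\<lambda>_. c)"
    using tree_gibbs_eq_iff[OF assms(1) sol assms(2)] z(1) by simp
  then show "\<mu> \<in> {tree_gibbs k lam (\<lambda>_. c)}"
    using gibbs_measure_iff[OF assms(1) sol] z(2) by simp
next
  fix \<mu> assume "\<mu> \<in> {tree_gibbs k lam (\<lambda>_. c)}"
  then have "gibbs_measure k lam (\<lambda>_. c) \<mu>" using gibbs_measure_iff[OF assms] by simp
  then show "\<mu> \<in> TIGMs k lam" by (auto simp: TIGMs_def)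
qed

section \<open>Alternative Gibbs measures correspond to solutions of the system\<close>

abbreviation labelling :: "(nat list \<Rightarrow> symbol) \<Rightarrow> real \<Rightarrow> real \<Rightarrow> nat list \<Rightarrow> real" where
  "labelling a h l \<equiv> \<lambda>x. case a x of H \<Rightarrow> h | L \<Rightarrow> l"

lemma not_H_iff: "s \<noteq> H \<longleftrightarrow> s = L"
  by (cases s) auto

lemma prod_over_symbols:
  fixes f :: "symbol \<Rightarrow> 'b::comm_monoid_mult"
  assumes "finite S"
  shows "(\<Prod>y\<in>S. f (a y)) = f H ^ card {y \<in> S. a y = H} * f L ^ card {y \<in> S. a y = L}"
proof -
  have "(\<Prod>y\<in>S. f (a y)) = (\<Prod>y\<in>S. if a y = H then f H else f L)"
    by (rule prod.cong) (simp_all add: not_H_iff)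
  also have "\<dots> = f H ^ card {y \<in> S. a y = H} * f L ^ card {y \<in> S. a y \<noteq> H}"
    using assms by (simp add: prod.If_cases Int_def)
  finally show ?thesis
    by (simp only: not_H_iff)
qed

lemma hc_solution_labelling:
  assumes a: "arrangement k m r a" and sys: "agm_system k m r lam h l"
  shows "hc_solution k lam (labelling a h l)"
  unfolding hc_solution_def
proof (intro ballI conjI)
  fix x assume x: "x \<in> tree_vertices k"
  show "0 < labelling a h l x"
    using sys by (auto simp: agm_system_def split: symbol.split)
  have "(\<Prod>y\<in>succs k x. inverse (1 + lam * labelling a h l y)) =
      inverse (1 + lam * h) ^ card {y \<in> succs k x. a y = H} * inverse (1 + lam * l) ^ card {y \<in> succs k x. a y = L}"
    using prod_over_symbols[OF finite_succs, of "\<lambda>s. inverse (1 + lam * (case s of H \<Rightarrow> h | L \<Rightarrow> l))" a k x]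
    by simp
  also have "\<dots> = labelling a h l x"
  proof (cases "a x")
    case H
    then have "card {y \<in> succs k x. a y = H} = m" "card {y \<in> succs k x. a y = L} = k - m"
      using a x unfolding arrangement_def by blast+
    then show ?thesis
      using sys H by (simp add: agm_system_def inverse_eq_divide power_one_over)
  next
    case L
    then have "card {y \<in> succs k x. a y = L} = r" "card {y \<in> succs k x. a y = H} = k - r"
      using a x unfolding arrangement_def by blast+
    then show ?thesis
      using sys L by (simp add: agm_system_def inverse_eq_divide power_one_over mult.commute)
  qed
  finally show "labelling a h l x = (\<Prod>y\<in>succs k x. inverse (1 + lam * labelling a h l y))"
    by (rule sym)
qed

lemma AGMs_eq:
  assumes "lam > 0" "arrangement k m r a"
  shows "AGMs k m r lam a =
    (\<lambda>(h, l). tree_gibbs k lam (labelling a h l)) ` {(h, l). agm_system k m r lam h l}"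
proof -
  have "(agm_system k m r lam h l \<and> gibbs_measure k lam (labelling a h l) \<mu>) \<longleftrightarrow>
      (agm_system k m r lam h l \<and> \<mu> = tree_gibbs k lam (labelling a h l))" for h l \<mu>
    using gibbs_measure_iff[OF assms(1) hc_solution_labelling[OF assms(2)]] by blast
  then show ?thesis unfolding AGMs_def by auto
qed

text \<open>
  If \<open>m, r < k\<close>, the root has a child that carries the other symbol.
\<close>

lemma arrangement_both_symbols:
  assumes a: "arrangement k m r a" and "m < k" "r < k"
  shows "\<exists>x\<in>tree_vertices k. a x = s"
proof -
  have ne: "\<exists>x\<in>tree_vertices k. a x = t" if "card {y \<in> succs k []. a y = t} > 0" for t
  proof -
    have "{y \<in> succs k []. a y = t} \<noteq> {}" using that by (metis card.empty less_irrefl)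
    then show ?thesis using succs_subset[OF Nil_in_tree_vertices, of k] by blast
  qed
  have "a [] = H \<longrightarrow> card {y \<in> succs k []. a y = L} = k - m"
    "a [] = L \<longrightarrow> card {y \<in> succs k []. a y = H} = k - r"
    using a Nil_in_tree_vertices[of k] unfolding arrangement_def by blast+
  then show ?thesis
    using ne[of H] ne[of L] Nil_in_tree_vertices[of k] assms(2,3)
    by (cases s; cases "a []") auto
qed

lemma tree_gibbs_labelling_eq_iff:
  assumes "lam > 0" and a: "arrangement k m r a" "m < k" "r < k"
    and "agm_system k m r lam h l" "agm_system k m r lam h' l'"
  shows "tree_gibbs k lam (labelling a h l) = tree_gibbs k lam (labelling a h' l') \<longleftrightarrow> h = h' \<and> l = l'"
proof -
  obtain x y where "x \<in> tree_vertices k" "a x = H" "y \<in> tree_vertices k" "a y = L"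
    using arrangement_both_symbols[OF a, of H] arrangement_both_symbols[OF a, of L] by blast
  then have "(\<forall>x\<in>tree_vertices k. labelling a h l x = labelling a h' l' x) \<longleftrightarrow> h = h' \<and> l = l'"
    by (fastforce split: symbol.split)
  then show ?thesis
    using tree_gibbs_eq_iff[OF assms(1) hc_solution_labelling hc_solution_labelling] assms by metis
qed

lemma agm_system_diagonal:
  assumes "m \<le> k" "r \<le> k"
  shows "agm_system k m r lam c c \<longleftrightarrow> hc_solution k lam (\<lambda>_. c)"
  using assms by (auto simp: agm_system_def hc_solution_const_iff power_add[symmetric])

section \<open>Exchanging the two symbols\<close>

fun swap_symbol :: "symbol \<Rightarrow> symbol" where
  "swap_symbol H = L"
| "swap_symbol L = H"

lemma swap_symbol_eq_iff [simp]: "swap_symbol s = H \<longleftrightarrow> s = L" "swap_symbol s = L \<longleftrightarrow> s = H"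
  by (cases s; simp)+

lemma arrangement_swap: "arrangement k m r a \<Longrightarrow> arrangement k r m (swap_symbol \<circ> a)"
  by (auto simp: arrangement_def)

lemma AGMs_swap: "AGMs k m r lam a = AGMs k r m lam (swap_symbol \<circ> a)"
proof -
  have "labelling a h l = labelling (swap_symbol \<circ> a) l h" for h l
    by (auto simp: fun_eq_iff split: symbol.split)
  moreover have "agm_system k m r lam h l \<longleftrightarrow> agm_system k r m lam l h" for h l
    by (auto simp: agm_system_def)
  ultimately show ?thesis unfolding AGMs_def by metis
qed

section \<open>The system for k = 3, m = 1, r = 0\<close>

definition cubic_roots :: "real \<Rightarrow> real set" where
  "cubic_roots lam = {u. u > 0 \<and> (1 + u) ^ 3 = lam * u}"

text \<open>
  In the variables \<open>u = lam h\<close>, \<open>v = lam l\<close> the equations are \<open>u (1 + u) (1 + v)\<^sup>2 = lam\<close> and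
  \<open>v (1 + u)\<^sup>3 = lam\<close>. Their difference is \<open>(1 + u) (u - v) (1 - u v)\<close>, which leaves the diagonal and
  the hyperbola \<open>u v = 1\<close>; on the latter the second equation becomes the cubic.
\<close>

lemma agm_system_3_1_0_iff:
  assumes "lam > 0"
  shows "agm_system 3 1 0 lam h l \<longleftrightarrow>
    h = l \<and> hc_solution 3 lam (\<lambda>_. h) \<or> (\<exists>u\<in>cubic_roots lam. h = u / lam \<and> l = 1 / (lam * u))"
proof -
  have eqs: "agm_system 3 1 0 lam h l \<longleftrightarrow> h > 0 \<and> l > 0 \<and>
      h * ((1 + lam * h) * (1 + lam * l)\<^sup>2) = 1 \<and> l * (1 + lam * h) ^ 3 = 1"
  proof (cases "h > 0 \<and> l > 0")
    case True
    then have "1 + lam * h > 0" "1 + lam * l > 0" using assms by (simp_all add: add_pos_pos)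
    then have "(1 + lam * h) * (1 + lam * l)\<^sup>2 \<noteq> 0" "(1 + lam * h) ^ 3 \<noteq> 0" by simp_all
    then show ?thesis
      using True by (simp add: agm_system_def nonzero_eq_divide_eq)
  qed (auto simp: agm_system_def)
  show ?thesis
  proof
    assume sys: "agm_system 3 1 0 lam h l"
    define u v where "u = lam * h" and "v = lam * l"
    have pos: "u > 0" "v > 0" and u: "u * ((1 + u) * (1 + v)\<^sup>2) = lam" and v: "v * (1 + u) ^ 3 = lam"
      using sys assms unfolding eqs u_def v_def by (simp_all add: mult.assoc)
    have "(1 + u) * ((u - v) * (1 - u * v)) = u * ((1 + u) * (1 + v)\<^sup>2) - v * (1 + u) ^ 3"
      by (simp add: power2_eq_square power3_eq_cube algebra_simps)
    also have "\<dots> = 0" using u v by simp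
    finally have "u = v \<or> u * v = 1" using pos by simp
    then show "h = l \<and> hc_solution 3 lam (\<lambda>_. h) \<or>
      (\<exists>u\<in>cubic_roots lam. h = u / lam \<and> l = 1 / (lam * u))"
    proof
      assume "u = v"
      then have "h = l" using assms by (simp add: u_def v_def)
      then show ?thesis using sys agm_system_diagonal[of 1 3 0] by simp
    next
      assume uv: "u * v = 1"
      have "(1 + u) ^ 3 = (u * v) * (1 + u) ^ 3" using uv by simp
      also have "\<dots> = lam * u" using v by (simp add: mult_ac)
      finally have "u \<in> cubic_roots lam" using pos by (simp add: cubic_roots_def)
      moreover have "h = u / lam" using assms by (simp add: u_def)
      moreover have "l = 1 / (lam * u)"
        using uv assms pos by (simp add: nonzero_eq_divide_eq v_def mult_ac)
      ultimately show ?thesis by blast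
    qed
  next
    assume "h = l \<and> hc_solution 3 lam (\<lambda>_. h) \<or>
      (\<exists>u\<in>cubic_roots lam. h = u / lam \<and> l = 1 / (lam * u))"
    then show "agm_system 3 1 0 lam h l"
    proof (elim disjE bexE conjE)
      assume "h = l" "hc_solution 3 lam (\<lambda>_. h)"
      then show ?thesis using agm_system_diagonal[of 1 3 0] by simp
    next
      fix u assume u: "u \<in> cubic_roots lam" and hl: "h = u / lam" "l = 1 / (lam * u)"
      then have "u > 0" and cubic: "(1 + u) ^ 3 = lam * u" by (auto simp: cubic_roots_def)
      have "h * ((1 + lam * h) * (1 + lam * l)\<^sup>2) = (1 + u) ^ 3 / (lam * u)"
        using \<open>u > 0\<close> assms by (simp add: hl field_simps power2_eq_square power3_eq_cube)
      moreover have "l * (1 + lam * h) ^ 3 = (1 + u) ^ 3 / (lam * u)"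
        using assms by (simp add: hl)
      moreover have "(1 + u) ^ 3 / (lam * u) = 1" "h > 0" "l > 0"
        using \<open>u > 0\<close> assms cubic by (simp_all add: hl)
      ultimately show ?thesis
        unfolding eqs by (simp only: simp_thms)
    qed
  qed
qed

text \<open>
  At \<open>lam = 27 / 4\<close> the line \<open>lam u\<close> is tangent to the cubic at \<open>u = 1 / 2\<close>.
\<close>

lemma cubic_gap: "(1 + u) ^ 3 - 27 / 4 * u = (u - 1 / 2)\<^sup>2 * (u + 4)" for u :: real
  by (simp add: power2_eq_square power3_eq_cube field_simps)

lemma cubic_roots_subcritical:
  assumes "lam < 27 / 4"
  shows "cubic_roots lam = {}"
proof -
  have "(1 + u) ^ 3 > lam * u" if "u > 0" for u
  proof -
    have "lam * u < 27 / 4 * u" using assms that by (rule mult_strict_right_mono)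
    moreover have "(u - 1 / 2)\<^sup>2 * (u + 4) \<ge> 0" using that by simp
    ultimately show ?thesis using cubic_gap[of u] by simp
  qed
  then show ?thesis by (force simp: cubic_roots_def)
qed

lemma cubic_roots_critical: "cubic_roots (27 / 4) = {1 / 2}"
proof -
  have "u \<in> cubic_roots (27 / 4) \<longleftrightarrow> u = 1 / 2" for u
  proof -
    have "u \<in> cubic_roots (27 / 4) \<longleftrightarrow> u > 0 \<and> (u - 1 / 2)\<^sup>2 * (u + 4) = 0"
      by (simp add: cubic_roots_def cubic_gap[symmetric])
    then show ?thesis by auto
  qed
  then show ?thesis by blast
qed

text \<open>
  At \<open>u = 1 / 2\<close> the line now lies above the cubic, while at \<open>0\<close> and at \<open>lam\<close> it lies below, which gives a
  root on either side. The three roots of \<open>u\<^sup>3 + 3 u\<^sup>2 + (3 - lam) u + 1\<close> sum to \<open>-3\<close>, so a third positive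
  one is impossible; the proof divides by the linear factors of the two known roots.
\<close>

lemma cubic_roots_supercritical:
  assumes "lam > 27 / 4"
  obtains u v where "cubic_roots lam = {u, v}" "u < 1 / 2" "1 / 2 < v"
proof -
  define f where "f w = (1 + w) ^ 3 - lam * w" for w
  have cont: "continuous_on A f" for A unfolding f_def by (intro continuous_intros)
  have half: "f (1 / 2) < 0" using assms by (simp add: f_def power3_eq_cube)
  have "f 0 \<ge> 0" by (simp add: f_def)
  with half have "\<exists>w\<ge>0. w \<le> 1 / 2 \<and> f w = 0"
    by (intro IVT2') (auto intro: cont)
  then obtain u where u: "0 \<le> u" "u \<le> 1 / 2" "f u = 0" by blast
  have "u \<noteq> 0" using u(3) by (auto simp: f_def)
  moreover have "u \<noteq> 1 / 2" using u(3) half by force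
  ultimately have u': "0 < u" "u < 1 / 2" using u by simp_all
  have "f lam \<ge> 0"
    using assms by (simp add: f_def power3_eq_cube algebra_simps)
  with half have "\<exists>w\<ge>1 / 2. w \<le> lam \<and> f w = 0"
    using assms by (intro IVT') (auto intro: cont)
  then obtain v where v: "1 / 2 \<le> v" "f v = 0" by blast
  then have v': "1 / 2 < v" using half by (cases "v = 1 / 2") auto
  have roots: "cubic_roots lam = {w. w > 0 \<and> f w = 0}"
    by (auto simp: cubic_roots_def f_def)
  have "w \<in> {u, v}" if w: "w > 0" "f w = 0" for w
  proof (rule ccontr)
    assume "w \<notin> {u, v}"
    have "(w - u) * (w\<^sup>2 + w * u + u\<^sup>2 + 3 * (w + u) + 3 - lam) = f w - f u"
      "(v - u) * (v\<^sup>2 + v * u + u\<^sup>2 + 3 * (v + u) + 3 - lam) = f v - f u"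
      by (simp_all add: f_def power2_eq_square power3_eq_cube algebra_simps)
    then have "w\<^sup>2 + w * u + u\<^sup>2 + 3 * (w + u) + 3 - lam = 0"
      "v\<^sup>2 + v * u + u\<^sup>2 + 3 * (v + u) + 3 - lam = 0"
      using u v w u' v' \<open>w \<notin> {u, v}\<close> by auto
    moreover have "(w - v) * (w + v + u + 3) =
        (w\<^sup>2 + w * u + u\<^sup>2 + 3 * (w + u) + 3 - lam) - (v\<^sup>2 + v * u + u\<^sup>2 + 3 * (v + u) + 3 - lam)"
      by (simp add: power2_eq_square algebra_simps)
    ultimately have "(w - v) * (w + v + u + 3) = 0" by simp
    then show False using \<open>w \<notin> {u, v}\<close> w u' v' by simp
  qed
  then have "cubic_roots lam = {u, v}"
    using roots u v u' v' by auto
  then show thesis using u' v' that by blast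
qed

text \<open>
  The root \<open>u = 1\<close> is the one with \<open>h = l\<close>, so this is the only value of \<open>lam\<close> at which the two branches
  of solutions meet.
\<close>

lemma one_in_cubic_roots_iff: "1 \<in> cubic_roots lam \<longleftrightarrow> lam = 8"
  by (auto simp: cubic_roots_def)

section \<open>Counting the alternative Gibbs measures\<close>

text \<open>
  The root \<open>u\<close> stands for the solution \<open>h = u / lam\<close>, \<open>l = 1 / (lam u)\<close>, and \<open>M u\<close> for its AGM. As the
  measure determines \<open>h\<close> and \<open>l\<close>, distinct roots give distinct measures, and \<open>M u\<close> is the TIGM only if
  \<open>u / lam = 1 / (lam u)\<close>.
\<close>

lemma AGMs_1_0_by_cubic_roots:
  assumes lam: "lam > 0" and a: "arrangement 3 1 0 a"
  shows "\<exists>\<mu>\<^sub>0 M. TIGMs 3 lam = {\<mu>\<^sub>0} \<and> AGMs 3 1 0 lam a = insert \<mu>\<^sub>0 (M ` cubic_roots lam) \<and>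
    inj_on M (cubic_roots lam) \<and> (\<forall>u\<in>cubic_roots lam. M u = \<mu>\<^sub>0 \<longleftrightarrow> u = 1)"
proof -
  obtain c where c: "hc_solution 3 lam (\<lambda>_. c)" "\<And>c'. hc_solution 3 lam (\<lambda>_. c') \<Longrightarrow> c' = c"
    using ex1_hc_solution_const[OF lam, of 3] by blast
  define G where "G h l = tree_gibbs 3 lam (labelling a h l)" for h l
  define M where "M u = G (u / lam) (1 / (lam * u))" for u
  have sys_c: "agm_system 3 1 0 lam c c"
    using c(1) unfolding agm_system_3_1_0_iff[OF lam] by blast
  have sys_u: "agm_system 3 1 0 lam (u / lam) (1 / (lam * u))" if "u \<in> cubic_roots lam" for u
    using that unfolding agm_system_3_1_0_iff[OF lam] by blast
  have G_iff: "G h l = G h' l' \<longleftrightarrow> h = h' \<and> l = l'"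
    if "agm_system 3 1 0 lam h l" "agm_system 3 1 0 lam h' l'" for h l h' l'
    unfolding G_def using tree_gibbs_labelling_eq_iff[OF lam a _ _ that] by simp
  have "labelling a c c = (\<lambda>_. c)"
    by (auto simp: fun_eq_iff split: symbol.split)
  then have "TIGMs 3 lam = {G c c}"
    using TIGMs_eq[OF lam c(1)] by (simp add: G_def)
  moreover have sols: "{(h, l). agm_system 3 1 0 lam h l} =
      insert (c, c) ((\<lambda>u. (u / lam, 1 / (lam * u))) ` cubic_roots lam)"
  proof -
    have "agm_system 3 1 0 lam h l \<longleftrightarrow>
        (h, l) = (c, c) \<or> (\<exists>u\<in>cubic_roots lam. (h, l) = (u / lam, 1 / (lam * u)))" for h l
      unfolding agm_system_3_1_0_iff[OF lam] prod.inject using c by blast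
    then show ?thesis by (simp only: insert_def image_def) auto
  qed
  have "AGMs 3 1 0 lam a = insert (G c c) (M ` cubic_roots lam)"
    unfolding AGMs_eq[OF lam a] sols by (simp add: G_def M_def image_image)
  moreover have "inj_on M (cubic_roots lam)"
  proof (rule inj_onI)
    fix u v assume "u \<in> cubic_roots lam" "v \<in> cubic_roots lam" "M u = M v"
    then have "u / lam = v / lam"
      unfolding M_def by (simp only: G_iff[OF sys_u sys_u])
    then show "u = v" using lam by simp
  qed
  moreover have "M u = G c c \<longleftrightarrow> u = 1" if u: "u \<in> cubic_roots lam" for u
  proof -
    have "u > 0" using u by (simp add: cubic_roots_def)
    have "M u = G c c \<longleftrightarrow> u / lam = c \<and> 1 / (lam * u) = c"
      unfolding M_def by (rule G_iff[OF sys_u[OF u] sys_c])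
    also have "\<dots> \<longleftrightarrow> u = 1"
    proof
      assume "u / lam = c \<and> 1 / (lam * u) = c"
      then have "u / lam = 1 / (lam * u)" by simp
      then have "u * u = 1" using lam \<open>u > 0\<close> by (simp add: field_simps)
      then have "(u - 1) * (u + 1) = 0" by (simp add: algebra_simps)
      then show "u = 1" using \<open>u > 0\<close> by simp
    next
      assume "u = 1"
      then have "agm_system 3 1 0 lam (1 / lam) (1 / lam)" using sys_u[OF u] by simp
      then have "1 / lam = c" using c(2) agm_system_diagonal[of 1 3 0] by simp
      then show "u / lam = c \<and> 1 / (lam * u) = c" using \<open>u = 1\<close> by simp
    qed
    finally show ?thesis .
  qed
  ultimately show ?thesis by blast
qed

lemma AGMs_by_cubic_roots:
  assumes "lam > 0" "(m = 1 \<and> r = 0) \<or> (m = 0 \<and> r = 1)" "arrangement 3 m r a"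
  obtains \<mu>\<^sub>0 M where "TIGMs 3 lam = {\<mu>\<^sub>0}" "AGMs 3 m r lam a = insert \<mu>\<^sub>0 (M ` cubic_roots lam)"
    "inj_on M (cubic_roots lam)" "\<And>u. u \<in> cubic_roots lam \<Longrightarrow> M u = \<mu>\<^sub>0 \<longleftrightarrow> u = 1"
  using assms(2)
proof
  assume "m = 1 \<and> r = 0"
  then show thesis
    using AGMs_1_0_by_cubic_roots[OF assms(1), of a] assms(3) that by fastforce
next
  assume mr: "m = 0 \<and> r = 1"
  then have "arrangement 3 1 0 (swap_symbol \<circ> a)"
    using arrangement_swap assms(3) by blast
  from AGMs_1_0_by_cubic_roots[OF assms(1) this] show thesis
    using AGMs_swap[of 3 0 1 lam a] mr that by fastforce
qed

theorem theorem3: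
  fixes m r :: nat and lam :: real and a :: "nat list \<Rightarrow> symbol"
  assumes "(m = 1 \<and> r = 0) \<or> (m = 0 \<and> r = 1)"
    and "arrangement 3 m r a"
  shows "(0 < lam \<and> lam < 27 / 4 \<longrightarrow>
           (\<exists>\<mu>\<^sub>0. TIGMs 3 lam = {\<mu>\<^sub>0} \<and> AGMs 3 m r lam a = {\<mu>\<^sub>0})) \<and>
         (lam = 27 / 4 \<longrightarrow>
           (\<exists>\<mu>\<^sub>0 \<mu>'. TIGMs 3 lam = {\<mu>\<^sub>0} \<and> AGMs 3 m r lam a = {\<mu>\<^sub>0, \<mu>'} \<and>
                    \<mu>' \<notin> TIGMs 3 lam)) \<and>
         (lam > 27 / 4 \<and> lam \<noteq> 8 \<longrightarrow>
           (\<exists>\<mu>\<^sub>0 \<mu>\<^sub>1 \<mu>\<^sub>2. TIGMs 3 lam = {\<mu>\<^sub>0} \<and> AGMs 3 m r lam a = {\<mu>\<^sub>0, \<mu>\<^sub>1, \<mu>\<^sub>2} \<and>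
                    \<mu>\<^sub>1 \<noteq> \<mu>\<^sub>2 \<and> \<mu>\<^sub>1 \<notin> TIGMs 3 lam \<and> \<mu>\<^sub>2 \<notin> TIGMs 3 lam)) \<and>
         (lam = 8 \<longrightarrow>
           (\<exists>\<mu>\<^sub>0 \<mu>'. TIGMs 3 lam = {\<mu>\<^sub>0} \<and> AGMs 3 m r lam a = {\<mu>\<^sub>0, \<mu>'} \<and>
                    \<mu>' \<notin> TIGMs 3 lam))"
proof (cases "lam > 0")
  case True
  obtain \<mu>\<^sub>0 M where TI: "TIGMs 3 lam = {\<mu>\<^sub>0}"
    and AGM: "AGMs 3 m r lam a = insert \<mu>\<^sub>0 (M ` cubic_roots lam)"
    and inj: "inj_on M (cubic_roots lam)"
    and M_iff: "\<And>u. u \<in> cubic_roots lam \<Longrightarrow> M u = \<mu>\<^sub>0 \<longleftrightarrow> u = 1"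
    by (rule AGMs_by_cubic_roots[OF True assms]) (rule that)
  show ?thesis
  proof (intro conjI impI)
    assume "0 < lam \<and> lam < 27 / 4"
    then show "\<exists>\<mu>\<^sub>0. TIGMs 3 lam = {\<mu>\<^sub>0} \<and> AGMs 3 m r lam a = {\<mu>\<^sub>0}"
      using TI AGM cubic_roots_subcritical by auto
  next
    assume "lam = 27 / 4"
    then have "cubic_roots lam = {1 / 2}" by (simp only: cubic_roots_critical)
    then show "\<exists>\<mu>\<^sub>0 \<mu>'. TIGMs 3 lam = {\<mu>\<^sub>0} \<and> AGMs 3 m r lam a = {\<mu>\<^sub>0, \<mu>'} \<and> \<mu>' \<notin> TIGMs 3 lam"
      using TI AGM M_iff[of "1 / 2"] by auto
  next
    assume "lam > 27 / 4 \<and> lam \<noteq> 8"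
    then obtain u v where roots: "cubic_roots lam = {u, v}" "u < 1 / 2" "1 / 2 < v"
      using cubic_roots_supercritical by blast
    then have "u \<noteq> 1" "v \<noteq> 1"
      using one_in_cubic_roots_iff[of lam] \<open>lam > 27 / 4 \<and> lam \<noteq> 8\<close> by auto
    then have "M u \<noteq> \<mu>\<^sub>0" "M v \<noteq> \<mu>\<^sub>0" "M u \<noteq> M v"
      using roots M_iff inj by (auto simp: inj_on_def)
    then show "\<exists>\<mu>\<^sub>0 \<mu>\<^sub>1 \<mu>\<^sub>2. TIGMs 3 lam = {\<mu>\<^sub>0} \<and> AGMs 3 m r lam a = {\<mu>\<^sub>0, \<mu>\<^sub>1, \<mu>\<^sub>2} \<and>
        \<mu>\<^sub>1 \<noteq> \<mu>\<^sub>2 \<and> \<mu>\<^sub>1 \<notin> TIGMs 3 lam \<and> \<mu>\<^sub>2 \<notin> TIGMs 3 lam"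
      using TI AGM roots(1) by (intro exI[of _ \<mu>\<^sub>0] exI[of _ "M u"] exI[of _ "M v"]) simp
  next
    assume "lam = 8"
    then obtain u v where roots: "cubic_roots lam = {u, v}" "u < 1 / 2" "1 / 2 < v"
      using cubic_roots_supercritical[of 8] by auto
    \<comment> \<open>The root \<open>1\<close> exceeds \<open>1 / 2\<close>, so it is the larger of the two.\<close>
    then have "v = 1" "u \<noteq> 1"
      using one_in_cubic_roots_iff[of lam] \<open>lam = 8\<close> by auto
    then have "M v = \<mu>\<^sub>0" "M u \<noteq> \<mu>\<^sub>0" using roots M_iff by auto
    then show "\<exists>\<mu>\<^sub>0 \<mu>'. TIGMs 3 lam = {\<mu>\<^sub>0} \<and> AGMs 3 m r lam a = {\<mu>\<^sub>0, \<mu>'} \<and> \<mu>' \<notin> TIGMs 3 lam"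
      using TI AGM roots(1) by (intro exI[of _ \<mu>\<^sub>0] exI[of _ "M u"]) auto
  qed
qed simp

end
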